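(* Let $M$ be a compact metric space and let $F\colon\Sigma_k\times M\to\Sigma_k\times M$, $F(\vartheta,x)=(\sigma(\vartheta),f_{\vartheta_0}(x))$, be a step skew product with continuous fiber maps $f_1,\dots,f_k\colon M\to M$ over a measure-preserving shift map $(\Sigma_k,\mathscr{F},\mathbb{P},\sigma)$. Assume that $\mathbb{P}(S_F)=1$. Then: (1) The measure $v_{\mathbb{P}}=\hat\rho_*\mathbb{P}$ is the global attractor of $F_*|_{\mathcal{M}_{\mathbb{P}}}$. In particular, $F$ has a unique invariant measure with marginal $\mathbb{P}$, whose disintegration with respect to $\mathbb{P}$ is the Dirac delta measure $\delta_{\rho(\cdot)}$. (2) $(F,v_{\mathbb{P}})$ is isomorphic to $(\sigma,\mathbb{P})$. (3) $\mathrm{supp}\,v_{\mathbb{P}}=\overline{\mathrm{graph}\,(\rho|_{\mathrm{supp}\,\mathbb{P}})}$.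
   Context: $\Sigma_k=\{1,\dots,k\}^{\mathbb{Z}}$ with the product topology, $\sigma$ is the (left) shift map, $\mathscr{F}$ is the product $\sigma$-algebra, and $\mathbb{P}$ is a $\sigma$-invariant probability measure on $(\Sigma_k,\mathscr{F})$. $S_F=\{\vartheta\in\Sigma_k:\ \bigcap_{n\ge0}f_{\vartheta_{-1}}\circ\cdots\circ f_{\vartheta_{-n}}(M)\text{ is a singleton}\}$. The coding map is $\rho\colon S_F\to M$, $\rho(\vartheta)=\lim_{n\to\infty}f_{\vartheta_{-1}}\circ\cdots\circ f_{\vartheta_{-n}}(p)$ (the limit exists and is independent of $p\in M$), and $\hat\rho\colon S_F\to S_F\times M$, $\hat\rho(\vartheta)=(\vartheta,\rho(\vartheta))$. Here $\mathrm{graph}(\rho|_{\mathrm{supp}\,\mathbb{P}})=\{(\vartheta,\rho(\vartheta)):\vartheta\in S_F\cap\mathrm{supp}\,\mathbb{P}\}$, and $\mathrm{supp}$ denotes the support of a measure. $\mathcal{M}_{\mathbb{P}}$ is the set of Borel probability measures $\mu$ on $\Sigma_k\times M$ with marginal $\mathbb{P}$, i.e. $\Pi_*\mu=\mathbb{P}$, where $\Pi(\vartheta,x)=\vartheta$. $F_*$ is the push-forward, $F_*\nu(A)=\nu(F^{-1}(A))$. A measure $v\in\mathcal{M}_{\mathbb{P}}$ is the global attractor of $F_*|_{\mathcal{M}_{\mathbb{P}}}$ if $\lim_{n\to\infty}F_*^n\nu=v$ in the weak$*$ topology for every $\nu\in\mathcal{M}_{\mathbb{P}}$. A disintegration of $\mu\in\mathcal{M}_{\mathbb{P}}$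 with respect to $\mathbb{P}$ is a family $(\mu_\vartheta)_{\vartheta\in\Sigma_k}$ such that $\vartheta\mapsto\mu_\vartheta(B)$ is measurable for every Borel $B\subset M$, $\mu_\vartheta$ is a Borel probability measure on $M$ for $\mathbb{P}$-a.e. $\vartheta$, and $\mu(A)=\int\mu_\vartheta(\{x:(\vartheta,x)\in A\})\,d\mathbb{P}(\vartheta)$ for every Borel $A\subset\Sigma_k\times M$; it exists and is $\mathbb{P}$-a.e. unique. Measure-preserving systems $(T_1,\mu_1)$ on $X_1$ and $(T_2,\mu_2)$ on $X_2$ are isomorphic if there are measurable sets $M_i\subset X_i$ with $\mu_i(M_i)=1$ and $T_i(M_i)\subset M_i$ $(i=1,2)$, and an invertible measurable map $\phi\colon M_1\to M_2$ with measurable inverse such that $\phi_*\mu_1=\mu_2$ and $T_2\circ\phi=\phi\circ T_1$ on $M_1$. *)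

theory Defs
  imports "HOL-Probability.Probability"
begin

section \<open>Two-sided sequences and the shift\<close>

definition seqs :: "nat \<Rightarrow> (int \<Rightarrow> nat) set" where
  "seqs k = {\<theta>. \<forall>i. \<theta> i \<in> {1..k}}"

text \<open>The product sigma-algebra; its space is \<^term>\<open>seqs k\<close>.\<close>

definition seq_algebra :: "nat \<Rightarrow> (int \<Rightarrow> nat) measure" where
  "seq_algebra k = PiM (UNIV :: int set) (\<lambda>_. count_space {1..k})"

definition shift :: "(int \<Rightarrow> nat) \<Rightarrow> (int \<Rightarrow> nat)" where
  "shift \<theta> = (\<lambda>i. \<theta> (i + 1))"


section \<open>Measure-preserving systems, supports, weak-star convergence\<close>

definition push :: "('a \<Rightarrow> 'a) \<Rightarrow> 'a measure \<Rightarrow> 'a measure" where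
  "push T \<mu> = distr \<mu> \<mu> T"

definition measure_preserving_system :: "('a \<Rightarrow> 'a) \<Rightarrow> 'a measure \<Rightarrow> bool" where
  "measure_preserving_system T \<mu> \<longleftrightarrow>
     prob_space \<mu> \<and> T \<in> measurable \<mu> \<mu> \<and> push T \<mu> = \<mu>"

definition isomorphic_systems ::
    "('a \<Rightarrow> 'a) \<Rightarrow> 'a measure \<Rightarrow> ('b \<Rightarrow> 'b) \<Rightarrow> 'b measure \<Rightarrow> bool" where
  "isomorphic_systems T1 \<mu>1 T2 \<mu>2 \<longleftrightarrow>
     measure_preserving_system T1 \<mu>1 \<and> measure_preserving_system T2 \<mu>2 \<and>
     (\<exists>M1 M2 \<phi>.
        M1 \<in> sets \<mu>1 \<and> measure \<mu>1 M1 = 1 \<and> T1 ` M1 \<subseteq> M1 \<and>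
        M2 \<in> sets \<mu>2 \<and> measure \<mu>2 M2 = 1 \<and> T2 ` M2 \<subseteq> M2 \<and>
        bij_betw \<phi> M1 M2 \<and>
        \<phi> \<in> measurable (restrict_space \<mu>1 M1) (restrict_space \<mu>2 M2) \<and>
        the_inv_into M1 \<phi> \<in> measurable (restrict_space \<mu>2 M2) (restrict_space \<mu>1 M1) \<and>
        distr (restrict_space \<mu>1 M1) (restrict_space \<mu>2 M2) \<phi> = restrict_space \<mu>2 M2 \<and>
        (\<forall>x\<in>M1. T2 (\<phi> x) = \<phi> (T1 x)))"

text \<open>The ambient type may be larger than the space of the measure; the open subsets of
  \<^term>\<open>space \<mu>\<close> are the traces of open sets.\<close>

definition supp :: "'a::topological_space measure \<Rightarrow> 'a set" where
  "supp \<mu> = {x \<in> space \<mu>. \<forall>U. open U \<and> x \<in> U \<longrightarrow> emeasure \<mu> (U \<inter> space \<mu>) > 0}"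

text \<open>Only used on compact spaces, where continuous test functions are automatically bounded.\<close>

definition weak_star_conv ::
    "(nat \<Rightarrow> 'a::topological_space measure) \<Rightarrow> 'a measure \<Rightarrow> bool" where
  "weak_star_conv \<mu> \<nu> \<longleftrightarrow>
     (\<forall>g :: 'a \<Rightarrow> real. continuous_on (space \<nu>) g \<longrightarrow>
        (\<lambda>n. \<integral>x. g x \<partial>\<mu> n) \<longlonglongrightarrow> (\<integral>x. g x \<partial>\<nu>))"


section \<open>Step skew products\<close>

definition skew :: "(nat \<Rightarrow> 'm \<Rightarrow> 'm) \<Rightarrow> (int \<Rightarrow> nat) \<times> 'm \<Rightarrow> (int \<Rightarrow> nat) \<times> 'm" where
  "skew f = (\<lambda>(\<theta>, x). (shift \<theta>, f (\<theta> 0) x))"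

text \<open>The composition \<open>f (\<theta> (-1)) \<circ> \<dots> \<circ> f (\<theta> (-n))\<close>.\<close>

primrec back_comp :: "(nat \<Rightarrow> 'm \<Rightarrow> 'm) \<Rightarrow> (int \<Rightarrow> nat) \<Rightarrow> nat \<Rightarrow> 'm \<Rightarrow> 'm" where
  "back_comp f \<theta> 0 = id"
| "back_comp f \<theta> (Suc n) = back_comp f \<theta> n \<circ> f (\<theta> (- int (Suc n)))"

definition S_set :: "nat \<Rightarrow> (nat \<Rightarrow> 'm \<Rightarrow> 'm) \<Rightarrow> (int \<Rightarrow> nat) set" where
  "S_set k f = {\<theta> \<in> seqs k. is_singleton (\<Inter>n. range (back_comp f \<theta> n))}"

text \<open>The description in the body expresses that the limit exists and does not depend on the
  starting point. As a partial function with domain \<^term>\<open>S_set k f\<close>, the coding map takes the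
  constant value \<^term>\<open>undefined\<close> elsewhere.\<close>

definition coding :: "nat \<Rightarrow> (nat \<Rightarrow> 'm \<Rightarrow> 'm) \<Rightarrow> (int \<Rightarrow> nat) \<Rightarrow> 'm::topological_space" where
  "coding k f = (\<lambda>\<theta>\<in>S_set k f. THE y. \<forall>p. (\<lambda>n. back_comp f \<theta> n p) \<longlonglongrightarrow> y)"

definition coding_hat ::
    "nat \<Rightarrow> (nat \<Rightarrow> 'm \<Rightarrow> 'm) \<Rightarrow> (int \<Rightarrow> nat) \<Rightarrow> (int \<Rightarrow> nat) \<times> 'm::topological_space" where
  "coding_hat k f \<theta> = (\<theta>, coding k f \<theta>)"


section \<open>Measures on the total space\<close>

definition total_borel :: "nat \<Rightarrow> ((int \<Rightarrow> nat) \<times> 'm::topological_space) measure" where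
  "total_borel k = restrict_space borel (seqs k \<times> UNIV)"

definition marginal_measures ::
    "nat \<Rightarrow> (int \<Rightarrow> nat) measure \<Rightarrow> ((int \<Rightarrow> nat) \<times> 'm::topological_space) measure set" where
  "marginal_measures k P =
     {\<mu>. prob_space \<mu> \<and> sets \<mu> = sets (total_borel k) \<and> distr \<mu> P fst = P}"

text \<open>Since the map being pushed forward lives on \<^term>\<open>S_set k f\<close> only, \<^term>\<open>P\<close> is first
  restricted to that set, which is meant to have full measure.\<close>

definition graph_measure ::
    "nat \<Rightarrow> (nat \<Rightarrow> 'm \<Rightarrow> 'm) \<Rightarrow> (int \<Rightarrow> nat) measure
      \<Rightarrow> ((int \<Rightarrow> nat) \<times> 'm::topological_space) measure" where
  "graph_measure k f P = distr (restrict_space P (S_set k f)) (total_borel k) (coding_hat k f)"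

definition global_attractor ::
    "('a \<Rightarrow> 'a) \<Rightarrow> 'a::topological_space measure set \<Rightarrow> 'a measure \<Rightarrow> bool" where
  "global_attractor T \<M> v \<longleftrightarrow>
     v \<in> \<M> \<and> (\<forall>\<nu>\<in>\<M>. weak_star_conv (\<lambda>n. (push T ^^ n) \<nu>) v)"

definition is_disintegration ::
    "'a measure \<Rightarrow> ('a \<times> 'm::topological_space) measure \<Rightarrow> ('a \<Rightarrow> 'm measure) \<Rightarrow> bool" where
  "is_disintegration P \<mu> \<kappa> \<longleftrightarrow>
     (\<forall>B\<in>sets borel. (\<lambda>\<theta>. emeasure (\<kappa> \<theta>) B) \<in> borel_measurable P) \<and>
     (AE \<theta> in P. prob_space (\<kappa> \<theta>) \<and> sets (\<kappa> \<theta>) = sets borel) \<and>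
     (\<forall>A\<in>sets \<mu>. emeasure \<mu> A = (\<integral>\<^sup>+\<theta>. emeasure (\<kappa> \<theta>) {x. (\<theta>, x) \<in> A} \<partial>P))"

end

theory Submission
  imports Defs
begin

text \<open>
  Write \<open>B\<^sub>n(\<theta>)\<close> for the composition of the fibre maps along the last \<open>n\<close> past symbols of \<open>\<theta>\<close>.
  The images of \<open>B\<^sub>n(\<theta>)\<close> form a nested sequence of compact sets, and \<open>S\<close> consists of the sequences
  for which they have one common point \<open>\<rho>(\<theta>)\<close>; by compactness they then shrink to it
  (\<open>coding_neighbourhood\<close>). Two further facts carry the proof. First, the \<open>n\<close>-th iterate of the skew
  product sends \<open>(\<theta>, x)\<close> to \<open>(\<eta>, B\<^sub>n(\<eta>) x)\<close> where \<open>\<eta>\<close> is the \<open>n\<close>-th shift of \<open>\<theta>\<close>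
  (\<open>skew_funpow\<close>), so pullback contraction at \<open>\<eta>\<close> controls the forward iterates. Second, \<open>B\<^sub>n(\<theta>)\<close> is
  a locally constant function of \<open>\<theta>\<close> (\<open>open_back_comp\<close>), which makes \<open>\<rho>\<close> continuous on \<open>S\<close>
  (\<open>continuous_on_coding\<close>) and the events of small or large image diameter open.

  Attraction. Given a continuous test function, the point \<open>(\<eta>, B\<^sub>n(\<eta>) x)\<close> and the graph point
  \<open>(\<eta>, \<rho>(\<eta>))\<close> give nearly the same value unless the image of \<open>B\<^sub>n(\<eta>)\<close> contains two
  points at distance at least some \<open>\<delta>\<close>. Since \<open>\<eta>\<close> has law \<open>P\<close> whenever \<open>\<theta>\<close> has, the probability of this event is that of a decreasing
  sequence of sets with null intersection (\<open>large_diameter_tendsto_0\<close>, \<open>weak_star_conv_graph_measure\<close>).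

  Invariant measures. Applying a fibre map to the shrinking images gives
  \<open>\<rho>(\<sigma> \<theta>) = f\<^bsub>\<theta>(0)\<^esub>(\<rho>(\<theta>))\<close> (\<open>coding_shift\<close>), so the graph measure is invariant and the graph map
  conjugates the shift to the skew product. Conversely an invariant measure is concentrated on the
  intersection of the forward images of the whole space, which over \<open>S\<close> is the graph of \<open>\<rho>\<close>
  (\<open>graph_eq\<close>); its marginal then determines it (\<open>invariant_measure_eq\<close>). The same description shows
  that the graph is a Borel set.

  Support. Continuity of \<open>\<rho>\<close> on \<open>S\<close> puts the graph over the support of \<open>P\<close> into the support of the
  graph measure, and this part of the graph already has full measure because \<open>P\<close> is carried by its
  support (\<open>AE_in_supp\<close>).
\<close>

section \<open>Iterates and backward compositions\<close>

lemma shift_funpow: "(shift ^^ n) \<theta> = (\<lambda>i. \<theta> (i + int n))"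
  by (induction n) (auto simp: shift_def algebra_simps)

lemma back_comp_shift: "back_comp f (shift \<theta>) (Suc n) = f (\<theta> 0) \<circ> back_comp f \<theta> n"
proof (induction n)
  case 0
  then show ?case by (simp add: shift_def)
next
  case (Suc n)
  have "back_comp f (shift \<theta>) (Suc (Suc n))
      = back_comp f (shift \<theta>) (Suc n) \<circ> f (shift \<theta> (- int (Suc (Suc n))))"
    by (simp only: back_comp.simps)
  also have "shift \<theta> (- int (Suc (Suc n))) = \<theta> (- int (Suc n))"
    by (simp add: shift_def)
  finally show ?case
    by (simp only: Suc.IH comp_assoc back_comp.simps(2)[of f \<theta> n])
qed

text \<open>The forward orbit of a fibre is governed by backward compositions at the end point of the
  orbit in the base; this is what turns pullback convergence into convergence of push-forwards.\<close>

lemma skew_funpow: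
  "(skew f ^^ n) (\<theta>, x) = ((shift ^^ n) \<theta>, back_comp f ((shift ^^ n) \<theta>) n x)"
proof (induction n arbitrary: \<theta> x)
  case 0
  then show ?case by simp
next
  case (Suc n)
  have "(skew f ^^ Suc n) (\<theta>, x) = (skew f ^^ n) (shift \<theta>, f (\<theta> 0) x)"
    by (simp add: funpow_Suc_right skew_def del: funpow.simps)
  also have "\<dots> = ((shift ^^ Suc n) \<theta>, back_comp f ((shift ^^ Suc n) \<theta>) n (f (\<theta> 0) x))"
    using Suc.IH by (simp add: funpow_Suc_right del: funpow.simps)
  also have "\<theta> 0 = (shift ^^ Suc n) \<theta> (- int (Suc n))"
    by (simp only: shift_funpow) simp
  finally show ?case
    by (simp only: back_comp.simps comp_apply)
qed

lemma shift_seqs: "\<theta> \<in> seqs k \<Longrightarrow> shift \<theta> \<in> seqs k"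
  by (simp add: seqs_def shift_def)

lemma shift_funpow_seqs_iff: "(shift ^^ n) \<theta> \<in> seqs k \<longleftrightarrow> \<theta> \<in> seqs k"
proof
  assume *: "(shift ^^ n) \<theta> \<in> seqs k"
  have "\<theta> i \<in> {1..k}" for i
    using *[unfolded seqs_def shift_funpow, simplified, rule_format, of "i - int n"] by simp
  then show "\<theta> \<in> seqs k" by (simp add: seqs_def)
qed (simp add: seqs_def shift_funpow)

lemma image_skew_funpow:
  "(skew f ^^ n) ` (seqs k \<times> UNIV) = {(\<theta>, x). \<theta> \<in> seqs k \<and> x \<in> range (back_comp f \<theta> n)}"
proof (intro equalityI subsetI)
  fix z assume "z \<in> (skew f ^^ n) ` (seqs k \<times> UNIV)"
  then show "z \<in> {(\<theta>, x). \<theta> \<in> seqs k \<and> x \<in> range (back_comp f \<theta> n)}"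
    by (auto simp: skew_funpow shift_funpow_seqs_iff)
next
  fix z assume "z \<in> {(\<theta>, x). \<theta> \<in> seqs k \<and> x \<in> range (back_comp f \<theta> n)}"
  then obtain \<theta> x where z: "z = (\<theta>, back_comp f \<theta> n x)" and \<theta>: "\<theta> \<in> seqs k"
    by auto
  define \<eta> where "\<eta> = (\<lambda>i. \<theta> (i - int n))"
  have \<eta>: "(shift ^^ n) \<eta> = \<theta>"
    by (simp add: shift_funpow \<eta>_def)
  have "z = (skew f ^^ n) (\<eta>, x)"
    by (simp add: skew_funpow \<eta> z)
  moreover have "\<eta> \<in> seqs k"
    using \<theta> \<eta> shift_funpow_seqs_iff by metis
  ultimately show "z \<in> (skew f ^^ n) ` (seqs k \<times> UNIV)" by auto
qed

lemma range_back_comp_antimono: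
  "m \<le> n \<Longrightarrow> range (back_comp f \<theta> n) \<subseteq> range (back_comp f \<theta> m)"
  by (induction n rule: dec_induct) auto

section \<open>Topology of the sequence space\<close>

lemma continuous_on_coordinate:
  "continuous_on S (\<lambda>\<theta> :: int \<Rightarrow> nat. \<theta> i)"
  by (rule continuous_on_subset[OF continuous_on_product_coordinates]) simp

lemma open_coordinate: "open {\<theta> :: int \<Rightarrow> nat. \<theta> i \<in> A}"
  using open_vimage[OF Topological_Spaces.open_discrete[of A] continuous_on_coordinate[of UNIV i]]
  by (simp add: vimage_def)

text \<open>The composition of length \<open>n\<close> reads only \<open>n\<close> coordinates, so it is locally constant in the
  sequence. All measurability and semicontinuity statements below come from this.\<close>

lemma open_back_comp: "open {\<theta>. Q (back_comp f \<theta> n)}"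
proof (induction n arbitrary: Q)
  case 0
  then show ?case by simp
next
  case (Suc n)
  have "{\<theta>. Q (back_comp f \<theta> (Suc n))}
      = (\<Union>i. {\<theta>. \<theta> (- int (Suc n)) \<in> {i}} \<inter> {\<theta>. Q (back_comp f \<theta> n \<circ> f i)})"
    by auto
  moreover have "open \<dots>"
    using Suc[of "\<lambda>b. Q (b \<circ> f i)" for i]
    by (intro open_UN ballI open_Int open_coordinate) auto
  ultimately show ?case by metis
qed

lemma seqs_eq_PiE: "seqs k = PiE UNIV (\<lambda>_. {1..k})"
  by (auto simp: seqs_def PiE_def)

lemma compact_seqs: "compact (seqs k)"
proof -
  have "compactin (product_topology (\<lambda>_::int. euclidean :: nat topology) UNIV)
          (PiE UNIV (\<lambda>_. {1..k}))"
    by (simp add: compactin_PiE finite_imp_compact)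
  then show ?thesis
    by (simp add: euclidean_product_topology seqs_eq_PiE)
qed

lemma closed_seqs: "closed (seqs k)"
proof -
  have "- seqs k = (\<Union>i. {\<theta>. \<theta> i \<in> - {1..k}})"
    by (auto simp: seqs_def)
  moreover have "open \<dots>"
    by (intro open_UN ballI open_coordinate)
  ultimately show ?thesis
    unfolding closed_def by (simp only:)
qed

lemma continuous_on_shift: "continuous_on S shift"
  unfolding shift_def[abs_def]
  by (intro continuous_on_coordinatewise_then_product continuous_on_coordinate)

text \<open>The countable product of discrete spaces is second countable, so the product
  sigma-algebra is generated by the open sets.\<close>

lemma sets_seq_algebra: "sets (seq_algebra k) = sets (restrict_space borel (seqs k))"
proof (intro equalityI subsetI)
  have space1: "space (seq_algebra k) = seqs k"
    by (simp add: seq_algebra_def space_PiM seqs_eq_PiE)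
  have space2: "space (restrict_space borel (seqs k)) = seqs k"
    by (simp add: space_restrict_space)
  {
    fix A assume A: "A \<in> sets (seq_algebra k)"
    have "(\<lambda>\<theta>. \<theta>) \<in> measurable (restrict_space borel (seqs k)) (seq_algebra k)"
      unfolding seq_algebra_def
    proof (rule measurable_PiM_single')
      fix i :: int
      have "(\<lambda>\<theta> :: int \<Rightarrow> nat. \<theta> i) \<in> measurable (restrict_space borel (seqs k)) borel"
        by (intro borel_measurable_continuous_on_restrict continuous_on_coordinate)
      from measurable_sets[OF this, of "{a}" for a]
      have "(\<lambda>\<theta> :: int \<Rightarrow> nat. \<theta> i) -` {a} \<inter> space (restrict_space borel (seqs k))
          \<in> sets (restrict_space borel (seqs k))" for a
        by simp
      moreover have "(\<lambda>\<theta> :: int \<Rightarrow> nat. \<theta> i) \<in> space (restrict_space borel (seqs k)) \<rightarrow> {1..k}"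
        by (auto simp: space2 seqs_def)
      ultimately show "(\<lambda>\<theta> :: int \<Rightarrow> nat. \<theta> i)
          \<in> measurable (restrict_space borel (seqs k)) (count_space {1..k})"
        by (subst measurable_count_space_eq2) blast+
    next
      show "(\<lambda>\<omega>. \<omega>) \<in> space (restrict_space borel (seqs k)) \<rightarrow> UNIV \<rightarrow>\<^sub>E space (count_space {1..k})"
        by (auto simp: space2 seqs_def)
    qed
    from measurable_sets[OF this A] show "A \<in> sets (restrict_space borel (seqs k))"
      using sets.sets_into_space[OF A] by (simp add: space1 space2 Int_absorb2 vimage_def)
  next
    fix A assume "A \<in> sets (restrict_space borel (seqs k))"
    then obtain B where B: "B \<in> sets borel" and A: "A = seqs k \<inter> B"
      by (auto simp: sets_restrict_space)
    have "(\<lambda>\<theta>. \<theta>) \<in> measurable (seq_algebra k) (PiM UNIV (\<lambda>_::int. borel :: nat measure))"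
    proof (rule measurable_PiM_single')
      fix i :: int
      have "(\<lambda>\<theta>. \<theta> i) \<in> measurable (seq_algebra k) (count_space {1..k})"
        unfolding seq_algebra_def by (rule measurable_component_singleton) simp
      then show "(\<lambda>\<theta>. \<theta> i) \<in> measurable (seq_algebra k) borel"
        by (rule measurable_compose) (simp add: measurable_count_space_eq1)
    qed auto
    then have "(\<lambda>\<theta>. \<theta>) \<in> measurable (seq_algebra k) borel"
      using measurable_cong_sets[OF refl sets_PiM_equal_borel] by blast
    from measurable_sets[OF this B] show "A \<in> sets (seq_algebra k)"
      by (simp add: space1 A Int_commute vimage_def)
  }
qed

section \<open>The coding map\<close>

locale step_skew_product =
  fixes k :: nat and f :: "nat \<Rightarrow> 'm::metric_space \<Rightarrow> 'm"
  assumes compact_fiber: "compact (UNIV :: 'm set)"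
    and continuous_fiber_map: "i \<in> {1..k} \<Longrightarrow> continuous_on UNIV (f i)"
begin

lemma compact_total: "compact (seqs k \<times> (UNIV :: 'm set))"
  by (intro compact_Times compact_seqs compact_fiber)

lemma continuous_on_skew: "continuous_on (seqs k \<times> UNIV) (skew f)"
proof -
  let ?A = "\<lambda>i. {\<theta> :: int \<Rightarrow> nat. \<theta> 0 \<in> {i}} \<times> (UNIV :: 'm set)"
  have "continuous_on (\<Union>i\<in>{1..k}. ?A i) (skew f)"
  proof (rule continuous_on_open_UN)
    fix i assume i: "i \<in> {1..k}"
    show "open (?A i)"
      by (intro open_Times open_coordinate open_UNIV)
    have "continuous_on (?A i) (\<lambda>z. (shift (fst z), f i (snd z)))"
      using continuous_fiber_map[OF i]
      by (intro continuous_on_Pair continuous_on_compose2[OF continuous_on_shift[of UNIV]]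
          continuous_on_compose2[OF continuous_fiber_map[OF i]] continuous_on_fst
          continuous_on_snd continuous_on_id) auto
    then show "continuous_on (?A i) (skew f)"
      by (rule continuous_on_eq) (auto simp: skew_def)
  qed
  then show ?thesis
    by (rule continuous_on_subset) (auto simp: seqs_def)
qed

lemma skew_funpow_total: "(skew f ^^ n) ` (seqs k \<times> UNIV) \<subseteq> seqs k \<times> UNIV"
  unfolding image_skew_funpow by auto

lemma continuous_on_back_comp:
  assumes "\<theta> \<in> seqs k" shows "continuous_on UNIV (back_comp f \<theta> n)"
proof (induction n)
  case 0
  then show ?case by (simp add: id_def)
next
  case (Suc n)
  have "continuous_on UNIV (f (\<theta> (- int (Suc n))))"
    using assms by (intro continuous_fiber_map) (simp only: seqs_def mem_Collect_eq)
  then show ?case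
    unfolding back_comp.simps using Suc continuous_on_subset continuous_on_compose by blast
qed

lemma compact_range_back_comp:
  assumes "\<theta> \<in> seqs k" shows "compact (range (back_comp f \<theta> n))"
  by (intro compact_continuous_image continuous_on_back_comp assms compact_fiber)

text \<open>A nested sequence of compact sets shrinking to a point eventually enters every
  neighbourhood of it.\<close>

lemma range_back_comp_eventually_subset:
  assumes \<theta>: "\<theta> \<in> seqs k" and y: "(\<Inter>n. range (back_comp f \<theta> n)) \<subseteq> U" and U: "open U"
  shows "\<exists>N. range (back_comp f \<theta> N) \<subseteq> U"
proof -
  have "compact (- U)"
    using compact_Int_closed[OF compact_fiber, of "- U"] U by (simp add: open_closed)
  moreover have "open (- range (back_comp f \<theta> n))" for n
    using compact_range_back_comp[OF \<theta>] compact_imp_closed by (metis open_Compl)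
  moreover have "- U \<subseteq> (\<Union>n\<in>UNIV. - range (back_comp f \<theta> n))"
    using y by blast
  ultimately obtain C where C: "finite C" "- U \<subseteq> (\<Union>n\<in>C. - range (back_comp f \<theta> n))"
    by (rule compactE_image) auto
  have "range (back_comp f \<theta> (Max (insert 0 C))) \<subseteq> range (back_comp f \<theta> n)" if "n \<in> C" for n
    using that C(1) by (intro range_back_comp_antimono Max_ge) auto
  with C(2) have "range (back_comp f \<theta> (Max (insert 0 C))) \<subseteq> U" by blast
  then show ?thesis ..
qed

lemma coding_eqI:
  assumes \<theta>: "\<theta> \<in> seqs k" and y: "(\<Inter>n. range (back_comp f \<theta> n)) = {y}"
  shows "\<theta> \<in> S_set k f" "coding k f \<theta> = y"
proof -
  show S: "\<theta> \<in> S_set k f"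
    using assms by (simp add: S_set_def)
  have lim: "(\<lambda>n. back_comp f \<theta> n p) \<longlonglongrightarrow> y" for p
  proof (rule topological_tendstoI)
    fix U assume U: "open U" "y \<in> U"
    then have "(\<Inter>n. range (back_comp f \<theta> n)) \<subseteq> U"
      unfolding y by simp
    then obtain N where N: "range (back_comp f \<theta> N) \<subseteq> U"
      using range_back_comp_eventually_subset[OF \<theta> _ U(1)] by auto
    have "back_comp f \<theta> n p \<in> U" if "n \<ge> N" for n
      using range_back_comp_antimono[OF that, of f \<theta>] N by auto
    then show "\<forall>\<^sub>F n in sequentially. back_comp f \<theta> n p \<in> U"
      by (auto simp: eventually_sequentially)
  qed
  have "(THE y. \<forall>p. (\<lambda>n. back_comp f \<theta> n p) \<longlonglongrightarrow> y) = y"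
    by (rule the_equality) (use lim LIMSEQ_unique in \<open>blast+\<close>)
  then show "coding k f \<theta> = y"
    using S by (simp add: coding_def)
qed

lemma Inter_range_back_comp:
  assumes "\<theta> \<in> S_set k f"
  shows "(\<Inter>n. range (back_comp f \<theta> n)) = {coding k f \<theta>}"
  using assms coding_eqI(2)[of \<theta>] by (auto simp: S_set_def is_singleton_def)

lemma S_set_seqs: "\<theta> \<in> S_set k f \<Longrightarrow> \<theta> \<in> seqs k"
  by (simp add: S_set_def)

lemma coding_in_range: "\<theta> \<in> S_set k f \<Longrightarrow> coding k f \<theta> \<in> range (back_comp f \<theta> n)"
  using Inter_range_back_comp by blast

lemma coding_neighbourhood:
  assumes "\<theta> \<in> S_set k f" "open U" "coding k f \<theta> \<in> U"
  shows "\<exists>N. range (back_comp f \<theta> N) \<subseteq> U"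
  using range_back_comp_eventually_subset[OF S_set_seqs] Inter_range_back_comp assms by simp

text \<open>The images over the shifted sequence are the images over the original one mapped by a
  continuous map, and such a map carries sets shrinking to a point to sets shrinking to its
  image.\<close>

lemma coding_shift:
  assumes S: "\<theta> \<in> S_set k f"
  shows "shift \<theta> \<in> S_set k f" "coding k f (shift \<theta>) = f (\<theta> 0) (coding k f \<theta>)"
proof -
  let ?y = "coding k f \<theta>"
  have seq: "\<theta> \<in> seqs k" using S by (rule S_set_seqs)
  have cont: "continuous_on UNIV (f (\<theta> 0))"
    using seq by (intro continuous_fiber_map) (simp only: seqs_def mem_Collect_eq)
  have "f (\<theta> 0) ?y \<in> range (back_comp f (shift \<theta>) n)" for n
  proof -
    have "f (\<theta> 0) ?y \<in> range (back_comp f (shift \<theta>) (Suc n))"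
      unfolding back_comp_shift using coding_in_range[OF S, of n] by auto
    then show ?thesis
      using range_back_comp_antimono[of n "Suc n" f "shift \<theta>"] by auto
  qed
  moreover have "z = f (\<theta> 0) ?y" if z: "z \<in> (\<Inter>n. range (back_comp f (shift \<theta>) n))" for z
  proof (rule ccontr)
    assume "z \<noteq> f (\<theta> 0) ?y"
    moreover have "open (f (\<theta> 0) -` (- {z}))"
      using cont by (intro open_vimage) auto
    ultimately obtain N where N: "range (back_comp f \<theta> N) \<subseteq> f (\<theta> 0) -` (- {z})"
      using coding_neighbourhood[OF S, of "f (\<theta> 0) -` (- {z})"] by auto
    have "z \<in> range (back_comp f (shift \<theta>) (Suc N))"
      using z by blast
    with N show False
      unfolding back_comp_shift by auto
  qed
  ultimately have "(\<Inter>n. range (back_comp f (shift \<theta>) n)) = {f (\<theta> 0) ?y}"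
    by blast
  from coding_eqI[OF shift_seqs[OF seq] this]
  show "shift \<theta> \<in> S_set k f" "coding k f (shift \<theta>) = f (\<theta> 0) ?y" by auto
qed

lemma skew_coding_hat:
  "\<theta> \<in> S_set k f \<Longrightarrow> skew f (coding_hat k f \<theta>) = coding_hat k f (shift \<theta>)"
  by (simp add: skew_def coding_hat_def coding_shift)

text \<open>Nearby sequences share a long block of past symbols, hence the same small set containing
  both codes.\<close>

lemma continuous_on_coding: "continuous_on (S_set k f) (coding k f)"
  unfolding continuous_on_topological
proof (intro ballI allI impI)
  fix \<theta> U assume \<theta>: "\<theta> \<in> S_set k f" and U: "open U" "coding k f \<theta> \<in> U"
  then obtain N where N: "range (back_comp f \<theta> N) \<subseteq> U"
    using coding_neighbourhood by blast
  let ?V = "{\<eta>. range (back_comp f \<eta> N) \<subseteq> U}"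
  have "open ?V" by (rule open_back_comp)
  moreover have "\<theta> \<in> ?V" using N by simp
  moreover have "\<forall>\<eta>\<in>S_set k f. \<eta> \<in> ?V \<longrightarrow> coding k f \<eta> \<in> U"
    using coding_in_range by blast
  ultimately show "\<exists>V. open V \<and> \<theta> \<in> V \<and> (\<forall>\<eta>\<in>S_set k f. \<eta> \<in> V \<longrightarrow> coding k f \<eta> \<in> U)"
    by blast
qed

lemma continuous_on_coding_hat: "continuous_on (S_set k f) (coding_hat k f)"
  unfolding coding_hat_def by (intro continuous_intros continuous_on_coding)

text \<open>The forward images of the whole space have the images of the backward compositions as
  fibres, which describes the graph without reference to limits and makes it a Borel set.\<close>

lemma graph_eq:
  "coding_hat k f ` S_set k f
     = (S_set k f \<times> UNIV) \<inter> (\<Inter>n. (skew f ^^ n) ` (seqs k \<times> UNIV))"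
  (is "_ = ?R")
proof -
  have "z \<in> coding_hat k f ` S_set k f \<longleftrightarrow> z \<in> ?R" for z
  proof (cases "fst z \<in> S_set k f")
    case True
    then have "z \<in> ?R \<longleftrightarrow> snd z \<in> (\<Inter>n. range (back_comp f (fst z) n))"
      by (cases z) (simp add: image_skew_funpow S_set_seqs)
    also have "\<dots> \<longleftrightarrow> snd z = coding k f (fst z)"
      using Inter_range_back_comp[OF True] by simp
    also have "\<dots> \<longleftrightarrow> z \<in> coding_hat k f ` S_set k f"
      using True by (cases z) (auto simp: coding_hat_def)
    finally show ?thesis ..
  next
    case False
    then show ?thesis by (auto simp: coding_hat_def)
  qed
  then show ?thesis by blast
qed

end

section \<open>Push-forwards, supports and fibrewise uniform continuity\<close>

lemma push_funpow:
  assumes T: "T \<in> measurable \<mu> \<mu>"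
  shows "(push T ^^ n) \<mu> = distr \<mu> \<mu> (T ^^ n)"
proof (induction n)
  case 0
  then show ?case by (simp add: id_def)
next
  case (Suc n)
  have "(push T ^^ Suc n) \<mu> = distr (distr \<mu> \<mu> (T ^^ n)) (distr \<mu> \<mu> (T ^^ n)) T"
    by (simp add: Suc.IH push_def)
  also have "\<dots> = distr (distr \<mu> \<mu> (T ^^ n)) \<mu> T"
    by (rule distr_cong) simp_all
  also have "\<dots> = distr \<mu> \<mu> (T ^^ Suc n)"
    using measurable_compose_n[OF T] by (simp add: distr_distr T)
  finally show ?case .
qed

lemma distr_funpow_invariant:
  assumes "measure_preserving_system T \<mu>"
  shows "distr \<mu> \<mu> (T ^^ n) = \<mu>"
proof -
  have "(push T ^^ n) \<mu> = \<mu>"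
    using assms by (induction n) (auto simp: measure_preserving_system_def)
  then show ?thesis
    using assms push_funpow[of T \<mu> n] by (simp add: measure_preserving_system_def)
qed

lemma supp_eq_Diff: "supp \<mu> = space \<mu> - \<Union>{U. open U \<and> emeasure \<mu> (U \<inter> space \<mu>) = 0}"
  by (auto simp: supp_def zero_less_iff_neq_zero)

lemma closed_supp: "closed (space \<mu>) \<Longrightarrow> closed (supp \<mu>)"
  unfolding supp_eq_Diff by (intro closed_Diff open_Union) auto

text \<open>The complement of the support is covered by null members of a countable basis.\<close>

lemma AE_in_supp:
  fixes \<mu> :: "'a::second_countable_topology measure"
  assumes "\<And>U. open U \<Longrightarrow> U \<inter> space \<mu> \<in> sets \<mu>"
  shows "AE x in \<mu>. x \<in> supp \<mu>"
proof -
  obtain B :: "'a set set" where B: "countable B" "topological_basis B"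
    using ex_countable_basis by blast
  let ?N = "{U \<in> B. emeasure \<mu> (U \<inter> space \<mu>) = 0}"
  have "AE x in \<mu>. x \<notin> U" if "U \<in> ?N" for U
    using that assms topological_basis_open[OF B(2)]
    by (intro AE_I[of _ _ "U \<inter> space \<mu>"]) auto
  moreover have "countable ?N" using B(1) by simp
  ultimately have "AE x in \<mu>. \<forall>U\<in>?N. x \<notin> U"
    by (subst AE_ball_countable) auto
  with AE_space show ?thesis
  proof eventually_elim
    case (elim x)
    have "emeasure \<mu> (U \<inter> space \<mu>) > 0" if U: "open U" "x \<in> U" for U
    proof -
      obtain W where W: "W \<in> B" "x \<in> W" "W \<subseteq> U"
        using topological_basisE[OF B(2) U] by blast
      then have "0 < emeasure \<mu> (W \<inter> space \<mu>)"
        using elim by (auto simp: zero_less_iff_neq_zero)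
      also have "\<dots> \<le> emeasure \<mu> (U \<inter> space \<mu>)"
        using W U assms by (intro emeasure_mono) auto
      finally show ?thesis .
    qed
    with elim show ?case by (simp add: supp_def)
  qed
qed

text \<open>Uniform continuity in the metric factor alone, where the other factor is any compact
  space: finitely many product neighbourhoods of controlled oscillation cover the compact
  product.\<close>

lemma fiberwise_uniformly_continuous:
  fixes g :: "'a::topological_space \<times> 'b::metric_space \<Rightarrow> 'c::metric_space"
  assumes "compact K" "compact L" and g: "continuous_on (K \<times> L) g" and e: "e > 0"
  shows "\<exists>\<delta>>0. \<forall>a\<in>K. \<forall>x\<in>L. \<forall>y\<in>L. dist x y < \<delta> \<longrightarrow> dist (g (a, x)) (g (a, y)) < e"
proof -
  have "\<exists>V r. open V \<and> fst z \<in> V \<and> r > 0 \<and>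
      (\<forall>w\<in>K \<times> L. fst w \<in> V \<and> dist (snd z) (snd w) < r \<longrightarrow> dist (g z) (g w) < e / 2)"
    if z: "z \<in> K \<times> L" for z
  proof -
    have "open (ball (g z) (e / 2))" "g z \<in> ball (g z) (e / 2)"
      using e by auto
    then obtain A where A: "open A" "z \<in> A" "\<forall>w\<in>K \<times> L. w \<in> A \<longrightarrow> g w \<in> ball (g z) (e / 2)"
      using g z unfolding continuous_on_topological by meson
    obtain V W where VW: "open V" "open W" "z \<in> V \<times> W" "V \<times> W \<subseteq> A"
      using open_prod_elim[OF A(1,2)] by blast
    obtain r where r: "r > 0" "ball (snd z) r \<subseteq> W"
      using openE[OF VW(2), of "snd z"] VW(3) by (metis mem_Times_iff)
    have "dist (g z) (g w) < e / 2" if w: "w \<in> K \<times> L" "fst w \<in> V" "dist (snd z) (snd w) < r" for w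
    proof -
      have "w \<in> V \<times> W"
        using w r(2) by (cases w) auto
      then show ?thesis
        using A(3) VW(4) w(1) by auto
    qed
    with VW r(1) show ?thesis by (intro exI[of _ V] exI[of _ r]) auto
  qed
  then obtain V r where
    V: "\<And>z. z \<in> K \<times> L \<Longrightarrow> open (V z)" "\<And>z. z \<in> K \<times> L \<Longrightarrow> fst z \<in> V z" and
    r: "\<And>z. z \<in> K \<times> L \<Longrightarrow> r z > 0" and
    osc: "\<And>z w. z \<in> K \<times> L \<Longrightarrow> w \<in> K \<times> L \<Longrightarrow> fst w \<in> V z \<Longrightarrow> dist (snd z) (snd w) < r z
            \<Longrightarrow> dist (g z) (g w) < e / 2"
    by metis
  have "compact (K \<times> L)"
    using assms by (intro compact_Times)
  moreover have "open (V z \<times> ball (snd z) (r z / 2))" if "z \<in> K \<times> L" for z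
    using V(1)[OF that] by (intro open_Times) auto
  moreover have "K \<times> L \<subseteq> (\<Union>z\<in>K \<times> L. V z \<times> ball (snd z) (r z / 2))"
  proof
    fix z assume z: "z \<in> K \<times> L"
    then have "z \<in> V z \<times> ball (snd z) (r z / 2)"
      using V(2)[OF z] r[OF z] by (cases z) auto
    with z show "z \<in> (\<Union>z\<in>K \<times> L. V z \<times> ball (snd z) (r z / 2))" by blast
  qed
  ultimately obtain D where D: "D \<subseteq> K \<times> L" "finite D"
    "K \<times> L \<subseteq> (\<Union>z\<in>D. V z \<times> ball (snd z) (r z / 2))"
    by (rule compactE_image)
  \<comment> \<open>The number 1 keeps the minimum meaningful when the cover is empty.\<close>
  define \<delta> where "\<delta> = Min (insert 1 ((\<lambda>z. r z / 2) ` D))"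
  have "\<delta> > 0"
    using D r by (auto simp: \<delta>_def)
  moreover have "dist (g (a, x)) (g (a, y)) < e"
    if axy: "a \<in> K" "x \<in> L" "y \<in> L" "dist x y < \<delta>" for a x y
  proof -
    obtain z where z: "z \<in> D" "a \<in> V z" "dist (snd z) x < r z / 2"
      using D(3) axy(1,2) by auto
    have zKL: "z \<in> K \<times> L"
      using z(1) D(1) by auto
    have "\<delta> \<le> r z / 2"
      unfolding \<delta>_def using D(2) z(1) by (intro Min_le) auto
    then have "dist (snd z) y < r z"
      using dist_triangle[of "snd z" y x] z(3) axy(4) by linarith
    moreover have "dist (snd z) x < r z"
      using z(3) r[OF zKL] by linarith
    ultimately have "dist (g z) (g (a, x)) < e / 2" "dist (g z) (g (a, y)) < e / 2"
      using osc[OF zKL] axy z(2) by auto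
    then show ?thesis by (metis dist_commute dist_triangle_half_l)
  qed
  ultimately show ?thesis by blast
qed

section \<open>Measurability of the coding map\<close>

lemma space_total_borel: "space (total_borel k) = seqs k \<times> UNIV"
  by (simp add: total_borel_def space_restrict_space)

lemma closed_total: "closed (seqs k \<times> (UNIV :: 'a::topological_space set))"
  by (intro closed_Times closed_seqs closed_UNIV)

lemma sets_total_borel_iff:
  "A \<in> sets (total_borel k) \<longleftrightarrow> A \<subseteq> seqs k \<times> UNIV \<and> A \<in> sets borel"
  unfolding total_borel_def
  by (subst sets_restrict_space_iff) (auto intro: borel_closed closed_total)

locale step_skew_system = step_skew_product k f
  for k :: nat and f :: "nat \<Rightarrow> 'm::metric_space \<Rightarrow> 'm" +
  fixes P :: "(int \<Rightarrow> nat) measure"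
  assumes sets_P: "sets P = sets (seq_algebra k)"
    and shift_preserves: "measure_preserving_system shift P"
    and S_set_full: "measure P (S_set k f) = 1"
begin

abbreviation "T \<equiv> (total_borel k :: ((int \<Rightarrow> nat) \<times> 'm) measure)"
abbreviation "v \<equiv> graph_measure k f P"
abbreviation "S \<equiv> S_set k f"
abbreviation "\<rho> \<equiv> coding k f"
abbreviation "hat \<equiv> coding_hat k f"
abbreviation "G \<equiv> hat ` S"

sublocale P: prob_space P
  using shift_preserves by (simp add: measure_preserving_system_def)

lemma sets_P_borel: "sets P = sets (restrict_space borel (seqs k))"
  by (simp add: sets_P sets_seq_algebra)

lemma space_P: "space P = seqs k"
  using sets_eq_imp_space_eq[OF sets_P_borel] by (simp add: space_restrict_space)

lemma open_Int_seqs_sets: "open V \<Longrightarrow> V \<inter> seqs k \<in> sets P"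
  by (auto simp: sets_P_borel sets_restrict_space)

lemma S_set_sets: "S \<in> sets P"
  using S_set_full measure_notin_sets by fastforce

lemma AE_S_set: "AE \<theta> in P. \<theta> \<in> S"
  by (rule P.AE_prob_1[OF S_set_full])

lemma shift_measurable: "shift \<in> measurable P P"
  using shift_preserves by (simp add: measure_preserving_system_def)

lemma shift_funpow_measurable: "shift ^^ n \<in> measurable P P"
  by (rule measurable_compose_n[OF shift_measurable])

lemma measurable_P_piecewise:
  assumes "continuous_on S g" "continuous_on (seqs k - S) g"
  shows "g \<in> borel_measurable P"
proof (rule measurable_piecewise_restrict[of "{S, - S}"])
  fix \<Omega> assume \<Omega>: "\<Omega> \<in> {S, - S}"
  have sets: "sets (restrict_space P \<Omega>) = sets (restrict_space borel (seqs k \<inter> \<Omega>))"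
    using sets_restrict_space_cong[OF sets_P_borel] by (simp add: sets_restrict_restrict_space)
  have "continuous_on (seqs k \<inter> \<Omega>) g"
    using \<Omega> assms S_set_seqs by (auto simp: Diff_eq elim: continuous_on_subset)
  then show "g \<in> borel_measurable (restrict_space P \<Omega>)"
    using borel_measurable_continuous_on_restrict measurable_cong_sets[OF sets refl] by blast
  have "- S \<inter> space P = space P - S" by auto
  then show "\<Omega> \<inter> space P \<in> sets P"
    using \<Omega> S_set_sets by auto
qed auto

lemma coding_measurable: "\<rho> \<in> borel_measurable P"
proof (rule measurable_P_piecewise[OF continuous_on_coding])
  show "continuous_on (seqs k - S) \<rho>"
    by (rule continuous_on_eq[OF continuous_on_const[of _ undefined]]) (simp add: coding_def)
qed

lemma coding_hat_measurable: "hat \<in> measurable P T"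
proof -
  have "hat \<in> borel_measurable P"
  proof (rule measurable_P_piecewise[OF continuous_on_coding_hat])
    have "continuous_on (seqs k - S) (\<lambda>\<theta>. (\<theta>, undefined :: 'm))"
      by (intro continuous_intros)
    then show "continuous_on (seqs k - S) hat"
      by (rule continuous_on_eq) (simp add: coding_def coding_hat_def)
  qed
  then show ?thesis
    unfolding total_borel_def
    by (rule measurable_restrict_space2[rotated]) (auto simp: space_P coding_hat_def)
qed

lemma fst_measurable: "fst \<in> measurable T P"
proof -
  have "fst \<in> borel_measurable T"
    unfolding total_borel_def
    by (intro borel_measurable_continuous_on_restrict continuous_intros)
  then have "fst \<in> measurable T (restrict_space borel (seqs k))"
    by (rule measurable_restrict_space2[rotated]) (auto simp: space_total_borel)
  then show ?thesis
    using measurable_cong_sets[OF refl sets_P_borel] by blast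
qed

lemma skew_measurable: "skew f \<in> measurable T T"
proof -
  have "skew f \<in> borel_measurable T"
    unfolding total_borel_def
    by (intro borel_measurable_continuous_on_restrict continuous_on_skew)
  then show ?thesis
    unfolding total_borel_def
    by (rule measurable_restrict_space2[rotated])
      (auto simp: space_restrict_space skew_def shift_seqs)
qed

lemma skew_funpow_measurable: "skew f ^^ n \<in> measurable T T"
  by (rule measurable_compose_n[OF skew_measurable])

text \<open>The coding map is constant off the set where it is meaningful, so its graph map is
  measurable on the whole base and the restriction in the graph measure can be dropped.\<close>

lemma graph_measure_eq: "v = distr P T hat"
proof (rule measure_eqI)
  fix A assume "A \<in> sets v"
  then have A: "A \<in> sets T" by (simp add: graph_measure_def)
  have "emeasure v A = emeasure (restrict_space P S) (hat -` A \<inter> S)"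
    unfolding graph_measure_def
    using S_set_seqs
    by (subst emeasure_distr[OF measurable_restrict_space1[OF coding_hat_measurable] A])
      (auto simp: space_restrict_space space_P intro!: arg_cong[where f = "emeasure _"])
  also have "\<dots> = emeasure P (hat -` A \<inter> S)"
    using S_set_sets by (intro emeasure_restrict_space) auto
  also have "\<dots> = emeasure P (hat -` A \<inter> space P)"
  proof (rule emeasure_eq_AE)
    show "AE \<theta> in P. \<theta> \<in> hat -` A \<inter> S \<longleftrightarrow> \<theta> \<in> hat -` A \<inter> space P"
      using AE_S_set AE_space by eventually_elim auto
    have "hat -` A \<inter> S = (hat -` A \<inter> space P) \<inter> S"
      using sets.sets_into_space[OF S_set_sets] by auto
    then show "hat -` A \<inter> S \<in> sets P"
      using measurable_sets[OF coding_hat_measurable A] S_set_sets by auto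
  qed (rule measurable_sets[OF coding_hat_measurable A])
  also have "\<dots> = emeasure (distr P T hat) A"
    by (rule emeasure_distr[OF coding_hat_measurable A, symmetric])
  finally show "emeasure v A = emeasure (distr P T hat) A" .
qed (simp add: graph_measure_def)

lemma sets_v: "sets v = sets T"
  by (simp add: graph_measure_def)

lemma space_v: "space v = seqs k \<times> UNIV"
  using sets_eq_imp_space_eq[OF sets_v] by (simp add: space_total_borel)

lemma graph_measure_marginal: "v \<in> marginal_measures k P"
proof -
  have "distr v P fst = distr P P (\<lambda>\<theta>. \<theta>)"
    by (simp add: graph_measure_eq distr_distr fst_measurable coding_hat_measurable
        comp_def coding_hat_def)
  then show ?thesis
    using P.prob_space_distr[OF coding_hat_measurable]
    by (simp add: marginal_measures_def graph_measure_eq)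
qed

section \<open>Invariant measures\<close>

lemma graph_measure_invariant: "measure_preserving_system (skew f) v"
proof -
  have "distr v v (skew f) = distr v T (skew f)"
    by (rule distr_cong) (simp_all add: sets_v)
  also have "\<dots> = distr P T (skew f \<circ> hat)"
    by (simp add: graph_measure_eq distr_distr skew_measurable coding_hat_measurable)
  also have "\<dots> = distr P T (hat \<circ> shift)"
  proof (rule distr_cong_AE[OF refl refl])
    show "AE \<theta> in P. (skew f \<circ> hat) \<theta> = (hat \<circ> shift) \<theta>"
      using AE_S_set by eventually_elim (simp add: skew_coding_hat)
  qed (intro measurable_comp[OF coding_hat_measurable skew_measurable]
        measurable_comp[OF shift_measurable coding_hat_measurable])+
  also have "\<dots> = distr (distr P P shift) T hat"
    by (simp add: distr_distr shift_measurable coding_hat_measurable)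
  also have "\<dots> = v"
    using shift_preserves
    by (simp add: measure_preserving_system_def push_def graph_measure_eq)
  finally have "distr v v (skew f) = v" .
  moreover have "skew f \<in> measurable v v"
    using skew_measurable measurable_cong_sets[OF sets_v sets_v] by blast
  ultimately show ?thesis
    using graph_measure_marginal
    by (simp add: measure_preserving_system_def marginal_measures_def push_def)
qed

text \<open>Over a block of sequences that share the symbols read by the backward composition, the image
  is a product with a fixed compact set.\<close>

lemma closed_image_skew_funpow: "closed ((skew f ^^ n) ` (seqs k \<times> UNIV))"
proof -
  let ?B = "(\<lambda>\<theta>. back_comp f \<theta> n) ` seqs k"
  have "- ((skew f ^^ n) ` (seqs k \<times> UNIV))
      = (- seqs k) \<times> UNIV \<union> (\<Union>b\<in>?B. {\<theta>. back_comp f \<theta> n = b} \<times> (- range b))"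
    unfolding image_skew_funpow by auto
  moreover have "open (- range b)" if "b \<in> ?B" for b
    using that compact_range_back_comp by (auto intro!: compact_imp_closed open_Compl)
  moreover have "open {\<theta>. back_comp f \<theta> n = b}" for b
    by (rule open_back_comp)
  ultimately show ?thesis
    using closed_seqs
    by (auto simp: closed_def intro!: open_Un open_UN open_Times)
qed

lemma graph_sets: "G \<in> sets T"
proof -
  have "S \<times> UNIV = fst -` S \<inter> space T"
    using S_set_seqs by (auto simp: space_total_borel)
  then have "S \<times> UNIV \<in> sets T"
    using measurable_sets[OF fst_measurable S_set_sets] by simp
  moreover have "(skew f ^^ n) ` (seqs k \<times> UNIV) \<in> sets T" for n
    unfolding sets_total_borel_iff
    by (intro conjI skew_funpow_total borel_closed closed_image_skew_funpow)
  ultimately show ?thesis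
    unfolding graph_eq by (intro sets.Int sets.countable_INT) auto
qed

text \<open>An invariant measure is carried by every forward image of the whole space, hence by their
  intersection, which over a full set of sequences is the graph of the coding map. A measure
  carried by a graph is determined by its marginal.\<close>

lemma invariant_measure_eq:
  assumes \<mu>: "\<mu> \<in> marginal_measures k P" and inv: "measure_preserving_system (skew f) \<mu>"
  shows "\<mu> = v"
proof -
  have sets_\<mu>: "sets \<mu> = sets T" and marg: "distr \<mu> P fst = P"
    using \<mu> by (simp_all add: marginal_measures_def)
  have space_\<mu>: "space \<mu> = seqs k \<times> UNIV"
    using sets_eq_imp_space_eq[OF sets_\<mu>] by (simp add: space_total_borel)
  have fst: "fst \<in> measurable \<mu> P"
    using fst_measurable measurable_cong_sets[OF sets_\<mu> refl] by blast
  have "AE z in \<mu>. z \<in> (skew f ^^ n) ` (seqs k \<times> UNIV)" for n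
  proof -
    let ?K = "(skew f ^^ n) ` (seqs k \<times> UNIV)"
    have F: "skew f ^^ n \<in> measurable \<mu> \<mu>"
      using skew_funpow_measurable measurable_cong_sets[OF sets_\<mu> sets_\<mu>] by blast
    have K: "?K \<in> sets \<mu>"
      unfolding sets_\<mu> sets_total_borel_iff
      by (intro conjI skew_funpow_total borel_closed closed_image_skew_funpow)
    have "{x \<in> space \<mu>. x \<in> ?K} = ?K"
      using sets.sets_into_space[OF K] by auto
    with K have "(AE z in distr \<mu> \<mu> (skew f ^^ n). z \<in> ?K) \<longleftrightarrow> (AE z in \<mu>. (skew f ^^ n) z \<in> ?K)"
      by (intro AE_distr_iff[OF F]) simp
    moreover have "AE z in \<mu>. (skew f ^^ n) z \<in> ?K"
      using AE_space by eventually_elim (simp add: space_\<mu>)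
    ultimately show ?thesis
      unfolding distr_funpow_invariant[OF inv] by blast
  qed
  then have "AE z in \<mu>. \<forall>n. z \<in> (skew f ^^ n) ` (seqs k \<times> UNIV)"
    by (simp add: AE_all_countable)
  moreover have "AE z in \<mu>. fst z \<in> S"
    using AE_distrD[OF fst, of "\<lambda>\<theta>. \<theta> \<in> S"] AE_S_set unfolding marg by blast
  ultimately have AE_graph: "AE z in \<mu>. z = hat (fst z)"
  proof eventually_elim
    case (elim z)
    then have "z \<in> (S \<times> UNIV) \<inter> (\<Inter>n. (skew f ^^ n) ` (seqs k \<times> UNIV))"
      by (cases z) auto
    then have "z \<in> G" by (simp only: graph_eq)
    then show ?case by (auto simp: coding_hat_def)
  qed
  have "\<mu> = distr \<mu> T (\<lambda>z. z)"
    by (simp add: distr_id2 sets_\<mu>)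
  also have "\<dots> = distr \<mu> T (hat \<circ> fst)"
  proof (rule distr_cong_AE[OF refl refl])
    show "AE z in \<mu>. z = (hat \<circ> fst) z" using AE_graph by simp
    show "(\<lambda>z. z) \<in> measurable \<mu> T" by (rule measurable_ident_sets[OF sets_\<mu>])
    show "hat \<circ> fst \<in> measurable \<mu> T" by (rule measurable_comp[OF fst coding_hat_measurable])
  qed
  also have "\<dots> = distr (distr \<mu> P fst) T hat"
    by (simp add: distr_distr fst coding_hat_measurable)
  finally show ?thesis by (simp add: marg graph_measure_eq)
qed

lemma graph_measure_disintegration: "is_disintegration P v (\<lambda>\<theta>. return borel (\<rho> \<theta>))"
  unfolding is_disintegration_def
proof (intro conjI ballI)
  fix B :: "'m set" assume "B \<in> sets borel"
  then show "(\<lambda>\<theta>. emeasure (return borel (\<rho> \<theta>)) B) \<in> borel_measurable P"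
    using coding_measurable by simp
next
  show "AE \<theta> in P. prob_space (return borel (\<rho> \<theta>)) \<and> sets (return borel (\<rho> \<theta>)) = sets borel"
    by (simp add: prob_space_return)
next
  fix A assume "A \<in> sets v"
  then have A: "A \<in> sets T" by (simp add: sets_v)
  have section_borel: "{x. (\<theta>, x) \<in> A} \<in> sets borel" for \<theta>
  proof -
    have "Pair \<theta> \<in> borel_measurable borel"
      by (intro borel_measurable_continuous_onI continuous_intros)
    then show ?thesis
      using A measurable_sets[of "Pair \<theta>" borel borel A]
      by (simp add: sets_total_borel_iff vimage_def)
  qed
  have "emeasure v A = emeasure P (hat -` A \<inter> space P)"
    by (simp add: graph_measure_eq emeasure_distr[OF coding_hat_measurable A])
  also have "\<dots> = (\<integral>\<^sup>+\<theta>. indicator (hat -` A \<inter> space P) \<theta> \<partial>P)"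
    by (simp add: nn_integral_indicator measurable_sets[OF coding_hat_measurable A])
  also have "\<dots> = (\<integral>\<^sup>+\<theta>. emeasure (return borel (\<rho> \<theta>)) {x. (\<theta>, x) \<in> A} \<partial>P)"
    by (intro nn_integral_cong)
      (simp add: emeasure_return section_borel coding_hat_def indicator_def)
  finally show "emeasure v A = (\<integral>\<^sup>+\<theta>. emeasure (return borel (\<rho> \<theta>)) {x. (\<theta>, x) \<in> A} \<partial>P)" .
qed

section \<open>Convergence to the graph measure\<close>

text \<open>These events decrease because the images are nested, and no sequence whose images shrink to a
  point lies in all of them. They are measurable because membership depends on finitely many
  coordinates.\<close>

lemma large_diameter_tendsto_0:
  assumes "\<delta> > 0"
  shows "(\<lambda>n. measure P ({\<eta>. \<exists>x y. dist (back_comp f \<eta> n x) (back_comp f \<eta> n y) \<ge> \<delta>} \<inter> seqs k))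
           \<longlonglongrightarrow> 0"
proof -
  define B where "B n = {\<eta>. \<exists>x y. dist (back_comp f \<eta> n x) (back_comp f \<eta> n y) \<ge> \<delta>} \<inter> seqs k" for n
  have sets: "range B \<subseteq> sets P"
    unfolding B_def by (auto intro!: open_Int_seqs_sets open_back_comp)
  have "decseq B"
    unfolding decseq_Suc_iff by (auto simp: B_def)
  then have "(\<lambda>n. measure P (B n)) \<longlonglongrightarrow> measure P (\<Inter>n. B n)"
    using sets by (intro P.finite_Lim_measure_decseq)
  moreover have "measure P (\<Inter>n. B n) = 0"
  proof -
    have "\<theta> \<notin> (\<Inter>n. B n)" if \<theta>: "\<theta> \<in> S" for \<theta>
    proof -
      obtain N where N: "range (back_comp f \<theta> N) \<subseteq> ball (\<rho> \<theta>) (\<delta> / 2)"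
        using coding_neighbourhood[OF \<theta>, of "ball (\<rho> \<theta>) (\<delta> / 2)"] assms by auto
      have "dist (back_comp f \<theta> N x) (back_comp f \<theta> N y) < \<delta>" for x y
      proof -
        have "dist (\<rho> \<theta>) (back_comp f \<theta> N x) < \<delta> / 2" "dist (\<rho> \<theta>) (back_comp f \<theta> N y) < \<delta> / 2"
          using N by (auto simp: subset_eq)
        then show ?thesis by (metis dist_commute dist_triangle_half_l)
      qed
      then have "\<theta> \<notin> B N" by (auto simp: B_def not_le)
      then show ?thesis by blast
    qed
    then have "AE \<theta> in P. \<theta> \<notin> (\<Inter>n. B n)"
      using AE_S_set by (auto elim!: eventually_mono)
    then have "prob_space.prob P (\<Inter>n. B n) = 0"
      using sets by (subst P.prob_eq_0) (auto intro!: sets.countable_INT)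
    then show ?thesis .
  qed
  ultimately show ?thesis by (simp add: B_def)
qed

text \<open>At the end point of an orbit of length \<open>n\<close> the fibre coordinate lies in the image under the
  \<open>n\<close>-th backward composition, and so does the code of that end point. By uniform continuity a test
  function cannot separate the two unless this image has large diameter. As the shift preserves the
  base measure, the probability of that does not depend on the starting measure and tends to
  zero.\<close>

lemma weak_star_conv_graph_measure:
  assumes \<nu>: "\<nu> \<in> marginal_measures k P"
  shows "weak_star_conv (\<lambda>n. (push (skew f) ^^ n) \<nu>) v"
  unfolding weak_star_conv_def
proof (intro allI impI)
  fix g :: "(int \<Rightarrow> nat) \<times> 'm \<Rightarrow> real" assume "continuous_on (space v) g"
  then have g: "continuous_on (seqs k \<times> UNIV) g" by (simp add: space_v)
  have sets_\<nu>: "sets \<nu> = sets T" and marg: "distr \<nu> P fst = P" and "prob_space \<nu>"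
    using \<nu> by (simp_all add: marginal_measures_def)
  then interpret \<nu>: prob_space \<nu> by simp
  have space_\<nu>: "space \<nu> = seqs k \<times> UNIV"
    using sets_eq_imp_space_eq[OF sets_\<nu>] by (simp add: space_total_borel)
  have fst: "fst \<in> measurable \<nu> P"
    using fst_measurable measurable_cong_sets[OF sets_\<nu> refl] by blast
  have F: "skew f ^^ n \<in> measurable \<nu> \<nu>" for n
    using skew_funpow_measurable measurable_cong_sets[OF sets_\<nu> sets_\<nu>] by blast
  have gT: "g \<in> borel_measurable T"
    unfolding total_borel_def by (rule borel_measurable_continuous_on_restrict[OF g])
  then have g\<nu>: "g \<in> borel_measurable \<nu>"
    using measurable_cong_sets[OF sets_\<nu> refl] by blast
  obtain C where C: "\<And>z. z \<in> seqs k \<times> UNIV \<Longrightarrow> \<bar>g z\<bar> \<le> C"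
    using compact_imp_bounded[OF compact_continuous_image[OF g compact_total]]
    by (auto simp: bounded_iff)
  have code: "(\<lambda>z. hat ((shift ^^ n) (fst z))) \<in> measurable \<nu> T" for n
    using measurable_comp[OF measurable_comp[OF fst shift_funpow_measurable] coding_hat_measurable]
    by (simp add: comp_def)
  have push_eq: "(\<integral>z. g z \<partial>(push (skew f) ^^ n) \<nu>) = (\<integral>z. g ((skew f ^^ n) z) \<partial>\<nu>)" for n
    using F[of 1] by (simp add: push_funpow integral_distr[OF F g\<nu>])
  have graph_eq': "(\<integral>z. g z \<partial>v) = (\<integral>z. g (hat ((shift ^^ n) (fst z))) \<partial>\<nu>)" for n
  proof -
    have "v = distr (distr (distr \<nu> P fst) P (shift ^^ n)) T hat"
      by (simp add: marg distr_funpow_invariant[OF shift_preserves] graph_measure_eq)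
    also have "\<dots> = distr \<nu> T (\<lambda>z. hat ((shift ^^ n) (fst z)))"
      using measurable_comp[OF fst shift_funpow_measurable]
      by (simp add: distr_distr fst shift_funpow_measurable coding_hat_measurable comp_def)
    finally show ?thesis
      by (simp add: integral_distr[OF code gT])
  qed
  show "(\<lambda>n. \<integral>z. g z \<partial>(push (skew f) ^^ n) \<nu>) \<longlonglongrightarrow> (\<integral>z. g z \<partial>v)"
  proof (rule tendstoI)
    fix e :: real assume e: "e > 0"
    obtain \<delta> where \<delta>: "\<delta> > 0"
      "\<And>\<theta> x y. \<theta> \<in> seqs k \<Longrightarrow> dist x y < \<delta> \<Longrightarrow> dist (g (\<theta>, x)) (g (\<theta>, y)) < e / 2"
      using fiberwise_uniformly_continuous[OF compact_seqs compact_fiber g, of "e / 2"] e by auto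
    define B where
      "B n = {\<eta>. \<exists>x y. dist (back_comp f \<eta> n x) (back_comp f \<eta> n y) \<ge> \<delta>} \<inter> seqs k" for n
    have B_sets: "B n \<in> sets P" for n
      unfolding B_def by (intro open_Int_seqs_sets open_back_comp)
    have bound: "dist (\<integral>z. g z \<partial>(push (skew f) ^^ n) \<nu>) (\<integral>z. g z \<partial>v)
        \<le> e / 2 + 2 * C * measure P (B n)" for n
    proof -
      let ?end = "\<lambda>z :: (int \<Rightarrow> nat) \<times> 'm. (shift ^^ n) (fst z)"
      let ?h = "\<lambda>z. g ((skew f ^^ n) z) - g (hat (?end z))"
      have end_meas: "?end \<in> measurable \<nu> P"
        using measurable_comp[OF fst shift_funpow_measurable] by (simp add: comp_def)
      have end_distr: "distr \<nu> P ?end = P"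
        using distr_distr[OF shift_funpow_measurable fst, of n]
        by (simp add: marg distr_funpow_invariant[OF shift_preserves] comp_def)
      have int1: "integrable \<nu> (\<lambda>z. g ((skew f ^^ n) z))"
      proof (intro \<nu>.integrable_const_bound[of _ C] AE_I2 measurable_compose[OF F g\<nu>])
        fix z assume "z \<in> space \<nu>"
        then have "(skew f ^^ n) z \<in> seqs k \<times> UNIV"
          using skew_funpow_total[of n] unfolding space_\<nu> by blast
        then show "norm (g ((skew f ^^ n) z)) \<le> C"
          using C by simp
      qed
      have int2: "integrable \<nu> (\<lambda>z. g (hat (?end z)))"
        using C
        by (intro \<nu>.integrable_const_bound[of _ C] AE_I2 measurable_compose[OF code gT])
          (auto simp: space_\<nu> coding_hat_def shift_funpow_seqs_iff)
      have int3: "integrable \<nu> (\<lambda>z. indicator (B n) (?end z) :: real)"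
        by (intro \<nu>.integrable_const_bound[of _ 1] AE_I2
            measurable_compose[OF end_meas borel_measurable_indicator[OF B_sets]])
          (auto simp: indicator_def)
      have "AE z in \<nu>. ?end z \<in> S"
        using AE_distrD[OF end_meas, of "\<lambda>\<theta>. \<theta> \<in> S"] AE_S_set unfolding end_distr by blast
      then have pointwise: "AE z in \<nu>. \<bar>?h z\<bar> \<le> e / 2 + 2 * C * indicator (B n) (?end z)"
        using AE_space
      proof eventually_elim
        case (elim z)
        obtain \<theta> x where z: "z = (\<theta>, x)" by (cases z)
        define \<eta> where "\<eta> = (shift ^^ n) \<theta>"
        have \<eta>: "\<eta> \<in> S" "\<eta> \<in> seqs k"
          using elim(1) S_set_seqs by (auto simp: z \<eta>_def)
        have Fz: "(skew f ^^ n) (\<theta>, x) = (\<eta>, back_comp f \<eta> n x)"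
          by (simp add: \<eta>_def skew_funpow)
        show ?case
        proof (cases "\<eta> \<in> B n")
          case True
          have "\<bar>g (\<eta>, back_comp f \<eta> n x)\<bar> \<le> C" "\<bar>g (hat \<eta>)\<bar> \<le> C"
            using C \<eta>(2) by (auto simp: coding_hat_def)
          then show ?thesis
            using True e by (simp add: Fz z flip: \<eta>_def)
        next
          case False
          obtain y where "\<rho> \<eta> = back_comp f \<eta> n y"
            using coding_in_range[OF \<eta>(1)] by blast
          then have "dist (back_comp f \<eta> n x) (\<rho> \<eta>) < \<delta>"
            using False \<eta>(2) by (auto simp: B_def not_le)
          then have "dist (g (\<eta>, back_comp f \<eta> n x)) (g (hat \<eta>)) < e / 2"
            using \<delta>(2) \<eta>(2) by (simp add: coding_hat_def)
          then show ?thesis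
            using False by (simp add: Fz z dist_real_def flip: \<eta>_def)
        qed
      qed
      have "dist (\<integral>z. g z \<partial>(push (skew f) ^^ n) \<nu>) (\<integral>z. g z \<partial>v) = \<bar>\<integral>z. ?h z \<partial>\<nu>\<bar>"
        unfolding push_eq graph_eq'[of n] dist_real_def
        by (simp add: Bochner_Integration.integral_diff[OF int1 int2])
      also have "\<dots> \<le> (\<integral>z. \<bar>?h z\<bar> \<partial>\<nu>)"
        by (rule integral_abs_bound)
      also have "\<dots> \<le> (\<integral>z. e / 2 + 2 * C * indicator (B n) (?end z) \<partial>\<nu>)"
        using int1 int2 int3 by (intro integral_mono_AE pointwise) auto
      also have "\<dots> = e / 2 + 2 * C * (\<integral>z. indicator (B n) (?end z) \<partial>\<nu>)"
        using int3 by (simp add: \<nu>.prob_space)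
      also have "(\<integral>z. indicator (B n) (?end z) \<partial>\<nu>) = (\<integral>\<eta>. indicator (B n) \<eta> \<partial>distr \<nu> P ?end :: real)"
        by (rule integral_distr[OF end_meas borel_measurable_indicator[OF B_sets], symmetric])
      also have "\<dots> = measure P (B n)"
        using sets.sets_into_space[OF B_sets] by (simp add: end_distr Int_absorb2)
      finally show ?thesis .
    qed
    have "(\<lambda>n. measure P (B n)) \<longlonglongrightarrow> 0"
      unfolding B_def by (rule large_diameter_tendsto_0[OF \<delta>(1)])
    then have "(\<lambda>n. e / 2 + 2 * C * measure P (B n)) \<longlonglongrightarrow> e / 2 + 2 * C * 0"
      by (intro tendsto_intros)
    then have "\<forall>\<^sub>F n in sequentially. e / 2 + 2 * C * measure P (B n) < e"
      using e by (intro order_tendstoD(2)[of _ "e / 2 + 2 * C * 0"]) auto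
    then show "\<forall>\<^sub>F n in sequentially.
        dist (\<integral>z. g z \<partial>(push (skew f) ^^ n) \<nu>) (\<integral>z. g z \<partial>v) < e"
      by eventually_elim (use bound in \<open>rule le_less_trans\<close>)
  qed
qed

section \<open>Isomorphism with the base and the support\<close>

text \<open>The projection to the base and the graph map are inverse to each other between the graph
  and the set of sequences that have a code.\<close>

lemma isomorphic_to_shift: "isomorphic_systems (skew f) v shift P"
proof -
  have hat_inv: "the_inv_into G fst \<theta> = hat \<theta>" if "\<theta> \<in> S" for \<theta>
    using that by (intro the_inv_into_f_eq) (auto simp: coding_hat_def inj_on_def)
  have bij: "bij_betw fst G S"
    by (auto simp: bij_betw_def inj_on_def coding_hat_def image_iff)
  have graph_full: "measure v G = 1"
  proof -
    have "measure v G = measure P (hat -` G \<inter> space P)"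
      by (simp add: graph_measure_eq measure_distr[OF coding_hat_measurable graph_sets])
    also have "hat -` G \<inter> space P = S"
      using S_set_seqs by (auto simp: space_P coding_hat_def)
    finally show ?thesis by (simp add: S_set_full)
  qed
  have fst_v: "fst \<in> measurable v P"
    using fst_measurable measurable_cong_sets[OF sets_v refl] by blast
  have fst_G: "fst \<in> measurable (restrict_space v G) (restrict_space P S)"
    by (intro measurable_restrict_space2 measurable_restrict_space1 fst_v)
      (auto simp: space_restrict_space coding_hat_def)
  have hat_S: "hat \<in> measurable (restrict_space P S) (restrict_space v G)"
    using coding_hat_measurable measurable_cong_sets[OF refl sets_v]
    by (intro measurable_restrict_space2 measurable_restrict_space1)
      (auto simp: space_restrict_space)
  have inv_S: "the_inv_into G fst \<in> measurable (restrict_space P S) (restrict_space v G)"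
    using hat_S by (rule measurable_cong[THEN iffD1, rotated])
      (simp add: hat_inv space_restrict_space)
  have distr: "distr (restrict_space v G) (restrict_space P S) fst = restrict_space P S"
  proof (rule measure_eqI)
    fix A assume "A \<in> sets (distr (restrict_space v G) (restrict_space P S) fst)"
    then have A_S: "A \<in> sets (restrict_space P S)" by simp
    then have A: "A \<in> sets P" "A \<subseteq> S"
      using S_set_sets by (auto simp: sets_restrict_space_iff)
    have G_v: "G \<in> sets v" by (simp add: sets_v graph_sets)
    have fst_A: "fst -` A \<inter> G \<in> sets T"
    proof -
      have "fst -` A \<inter> G = (fst -` A \<inter> space T) \<inter> G"
        using sets.sets_into_space[OF graph_sets] by auto
      then show ?thesis
        using measurable_sets[OF fst_measurable A(1)] graph_sets by auto
    qed
    have "emeasure (distr (restrict_space v G) (restrict_space P S) fst) A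
        = emeasure (restrict_space v G) (fst -` A \<inter> G)"
      using sets.sets_into_space[OF G_v]
      by (simp add: emeasure_distr[OF fst_G A_S] space_restrict_space Int_absorb2)
    also have "\<dots> = emeasure v (fst -` A \<inter> G)"
      using G_v by (intro emeasure_restrict_space) auto
    also have "\<dots> = emeasure P (hat -` (fst -` A \<inter> G) \<inter> space P)"
      by (simp add: graph_measure_eq emeasure_distr[OF coding_hat_measurable fst_A])
    also have "hat -` (fst -` A \<inter> G) \<inter> space P = A"
      using A(2) S_set_seqs by (auto simp: space_P coding_hat_def)
    also have "emeasure P A = emeasure (restrict_space P S) A"
      using S_set_sets A by (intro emeasure_restrict_space[symmetric]) auto
    finally show "emeasure (distr (restrict_space v G) (restrict_space P S) fst) A
        = emeasure (restrict_space P S) A" .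
  qed simp
  have "skew f ` G \<subseteq> G"
    using skew_coding_hat coding_shift(1) by auto
  moreover have "shift ` S \<subseteq> S"
    using coding_shift(1) by auto
  moreover have "\<forall>z\<in>G. shift (fst z) = fst (skew f z)"
    by (simp add: skew_def case_prod_beta)
  ultimately show ?thesis
    unfolding isomorphic_systems_def
    using graph_measure_invariant shift_preserves graph_sets S_set_sets graph_full S_set_full
      bij fst_G inv_S distr sets_v
    by (intro conjI exI[of _ G] exI[of _ S] exI[of _ fst]) auto
qed

text \<open>A neighbourhood of a graph point pulls back to a neighbourhood of its base point because the
  coding map is continuous on its domain; conversely the base measure sees only sequences in its
  support, so the graph over the support carries the whole graph measure.\<close>

lemma supp_graph_measure: "supp v = closure (hat ` (S \<inter> supp P))"
proof (rule antisym)
  have "hat ` (S \<inter> supp P) \<subseteq> supp v"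
  proof (rule image_subsetI)
    fix \<theta> assume \<theta>: "\<theta> \<in> S \<inter> supp P"
    have "emeasure v (U \<inter> space v) > 0" if U: "open U" "hat \<theta> \<in> U" for U
    proof -
      have UT: "U \<inter> space v \<in> sets T"
        using sets.Int[OF borel_open[OF U(1)] borel_closed[OF closed_total]]
        by (simp add: space_v sets_total_borel_iff)
      obtain V where V: "open V" "V \<inter> S = hat -` U \<inter> S"
        using continuous_on_coding_hat U(1) unfolding continuous_on_open_invariant by blast
      have "\<theta> \<in> V" using V(2) U(2) \<theta> by blast
      then have "0 < emeasure P (V \<inter> space P)"
        using \<theta> V(1) by (simp add: supp_def)
      also have "\<dots> \<le> emeasure P (hat -` (U \<inter> space v) \<inter> space P)"
      proof (rule emeasure_mono_AE)
        show "AE \<eta> in P. \<eta> \<in> V \<inter> space P \<longrightarrow> \<eta> \<in> hat -` (U \<inter> space v) \<inter> space P"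
          using AE_S_set
        proof eventually_elim
          case (elim \<eta>)
          then show ?case
            using V(2) by (auto simp: space_v space_P coding_hat_def)
        qed
      qed (rule measurable_sets[OF coding_hat_measurable UT])
      also have "\<dots> = emeasure v (U \<inter> space v)"
        using UT by (simp add: graph_measure_eq emeasure_distr[OF coding_hat_measurable])
      finally show ?thesis .
    qed
    moreover have "hat \<theta> \<in> space v"
      using \<theta> S_set_seqs by (auto simp: space_v coding_hat_def)
    ultimately show "hat \<theta> \<in> supp v" by (simp add: supp_def)
  qed
  then show "closure (hat ` (S \<inter> supp P)) \<subseteq> supp v"
    by (intro closure_minimal closed_supp) (auto simp: space_v closed_total)
next
  show "supp v \<subseteq> closure (hat ` (S \<inter> supp P))"
  proof (rule subsetI, rule ccontr)
    fix z assume z: "z \<in> supp v" and "z \<notin> closure (hat ` (S \<inter> supp P))"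
    define U where "U = - closure (hat ` (S \<inter> supp P))"
    have U: "open U" "z \<in> U"
      using \<open>z \<notin> _\<close> by (auto simp: U_def)
    have UT: "U \<inter> space v \<in> sets T"
      using sets.Int[OF borel_open[OF U(1)] borel_closed[OF closed_total]]
      by (simp add: space_v sets_total_borel_iff)
    have "AE \<theta> in P. \<theta> \<in> supp P"
      by (rule AE_in_supp) (simp add: space_P open_Int_seqs_sets)
    with AE_S_set have "AE \<theta> in P. \<theta> \<notin> hat -` (U \<inter> space v) \<inter> space P"
    proof eventually_elim
      case (elim \<theta>)
      then have "hat \<theta> \<in> closure (hat ` (S \<inter> supp P))"
        by (intro subsetD[OF closure_subset] imageI) simp
      then show ?case by (simp add: U_def)
    qed
    then have "emeasure P (hat -` (U \<inter> space v) \<inter> space P) = 0"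
      using AE_iff_null_sets[OF measurable_sets[OF coding_hat_measurable UT]] by auto
    then have "emeasure v (U \<inter> space v) = 0"
      using UT by (simp add: graph_measure_eq emeasure_distr[OF coding_hat_measurable])
    with z U show False by (auto simp: supp_def)
  qed
qed

end

theorem theorem3:
  fixes k :: nat
    and f :: "nat \<Rightarrow> 'm::metric_space \<Rightarrow> 'm"
    and P :: "(int \<Rightarrow> nat) measure"
  assumes "compact (UNIV :: 'm set)"
    and "\<And>i. i \<in> {1..k} \<Longrightarrow> continuous_on UNIV (f i)"
    and "sets P = sets (seq_algebra k)"
    and "measure_preserving_system shift P"
    and "measure P (S_set k f) = 1"
  shows "global_attractor (skew f) (marginal_measures k P) (graph_measure k f P)
       \<and> (\<exists>!\<mu>. \<mu> \<in> marginal_measures k P \<and> measure_preserving_system (skew f) \<mu>)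
       \<and> (\<forall>\<mu> \<in> marginal_measures k P. measure_preserving_system (skew f) \<mu> \<longrightarrow>
            is_disintegration P \<mu> (\<lambda>\<theta>. return borel (coding k f \<theta>)))
       \<and> isomorphic_systems (skew f) (graph_measure k f P) shift P
       \<and> supp (graph_measure k f P)
           = closure {(\<theta>, coding k f \<theta>) |\<theta>. \<theta> \<in> S_set k f \<inter> supp P}"
proof -
  interpret step_skew_system k f P
    using assms by unfold_locales auto
  have "{(\<theta>, coding k f \<theta>) |\<theta>. \<theta> \<in> S_set k f \<inter> supp P}
      = coding_hat k f ` (S_set k f \<inter> supp P)"
    by (auto simp: coding_hat_def)
  moreover have "global_attractor (skew f) (marginal_measures k P) (graph_measure k f P)"
    using graph_measure_marginal weak_star_conv_graph_measure by (simp add: global_attractor_def)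
  moreover have "\<exists>!\<mu>. \<mu> \<in> marginal_measures k P \<and> measure_preserving_system (skew f) \<mu>"
    using graph_measure_marginal graph_measure_invariant invariant_measure_eq by blast
  moreover have "\<forall>\<mu> \<in> marginal_measures k P. measure_preserving_system (skew f) \<mu> \<longrightarrow>
      is_disintegration P \<mu> (\<lambda>\<theta>. return borel (coding k f \<theta>))"
    using invariant_measure_eq graph_measure_disintegration by blast
  ultimately show ?thesis
    using isomorphic_to_shift supp_graph_measure by simp
qed

end
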